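(* Let $\tilde{\boldsymbol{X}}_1,\dots,\tilde{\boldsymbol{X}}_m$ be i.i.d. random points in $\mathbb{R}^p$ (distributed as $\tilde{\boldsymbol{X}}$), whose distribution is symmetric about $\mathbf{0}$. If $$\rho := \sup_{\boldsymbol{v}\in\mathbb{S}^{p-1}} \frac{\mathbb{P}\big(|\langle \boldsymbol{v},\tilde{\boldsymbol{X}}\rangle|\le 2\xi\big)}{2} + \mathbb{P}\big(\|\tilde{\boldsymbol{X}}\|\ge \Upsilon\big) < \frac12$$ for some $\xi,\Upsilon>0$, then $$\mathbb{P}\big(\xi\,\mathbb{B}_2^p\not\subset \operatorname{conv}(\tilde{\boldsymbol{X}}_1,\dots,\tilde{\boldsymbol{X}}_m)\big)\le \Big(1+\frac{2\Upsilon}{\xi}\Big)^p\Big(\frac12+\rho\Big)^m .$$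
   Context: $\mathbb{S}^{p-1}$ is the unit Euclidean sphere in $\mathbb{R}^p$, $\mathbb{B}_2^p$ is the closed unit Euclidean ball centered at $\mathbf{0}$, $\|\cdot\|$ is the Euclidean norm, and $\operatorname{conv}$ denotes the convex hull. Symmetric about $\mathbf{0}$ means that $\tilde{\boldsymbol{X}}$ and $-\tilde{\boldsymbol{X}}$ have the same distribution. *)

theory Defs
  imports "HOL-Probability.Probability"
begin

end

theory Submission
  imports Defs
begin

text \<open>
  If a point of norm at most \<open>\<xi>\<close> lies outside the convex hull, separation yields a unit vector
  \<open>v\<close> with \<open>v \<bullet> X i < \<xi>\<close> for all \<open>i\<close>. Moving \<open>v\<close> to a nearby point \<open>u\<close> of a \<open>\<xi> / \<Upsilon>\<close>-net of
  the sphere costs at most \<open>\<xi>\<close> as long as \<open>norm (X i) < \<Upsilon>\<close>, so each \<open>X i\<close> satisfies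
  \<open>norm (X i) \<ge> \<Upsilon>\<close> or \<open>u \<bullet> X i \<le> 2 * \<xi>\<close>. For fixed \<open>u\<close> this has probability at most
  \<open>1 / 2 + \<rho>\<close> by symmetry; conclude by independence and a union bound over the net, whose size
  is controlled by comparing volumes.
\<close>

text \<open>Volume comparison: the open balls of radius \<open>\<epsilon> / 2\<close> about the
  points are pairwise disjoint and all lie in the ball of radius \<open>1 + \<epsilon> / 2\<close>
  about the origin.\<close>

lemma card_separated_le:
  fixes S :: "'a::euclidean_space set"
  assumes "finite S" "S \<subseteq> cball 0 1" "\<epsilon> > 0"
    and sep: "\<And>x y. x \<in> S \<Longrightarrow> y \<in> S \<Longrightarrow> x \<noteq> y \<Longrightarrow> dist x y \<ge> \<epsilon>"
  shows "real (card S) \<le> (1 + 2 / \<epsilon>) ^ DIM('a)"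
proof -
  let ?V = "unit_ball_vol (real DIM('a))"
  have disj: "disjoint_family_on (\<lambda>x. ball x (\<epsilon> / 2)) S"
    unfolding disjoint_family_on_def
  proof (intro ballI impI)
    fix x y assume "x \<in> S" "y \<in> S" "x \<noteq> y"
    then have "dist x y \<ge> \<epsilon>" by (rule sep)
    then show "ball x (\<epsilon> / 2) \<inter> ball y (\<epsilon> / 2) = {}"
      by (intro disjoint_ballI) auto
  qed
  have sub: "(\<Union>x\<in>S. ball x (\<epsilon> / 2)) \<subseteq> ball 0 (1 + \<epsilon> / 2)"
  proof
    fix z assume "z \<in> (\<Union>x\<in>S. ball x (\<epsilon> / 2))"
    then obtain x where "x \<in> S" "dist x z < \<epsilon> / 2" by auto
    moreover have "norm x \<le> 1" using \<open>x \<in> S\<close> assms(2) by auto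
    ultimately show "z \<in> ball 0 (1 + \<epsilon> / 2)"
      using dist_triangle[of 0 z x] by simp
  qed
  have "real (card S) * (?V * (\<epsilon> / 2) ^ DIM('a)) = (\<Sum>x\<in>S. measure lebesgue (ball x (\<epsilon> / 2)))"
    using \<open>\<epsilon> > 0\<close> by (simp add: content_ball)
  also have "\<dots> = measure lebesgue (\<Union>x\<in>S. ball x (\<epsilon> / 2))"
    using disj \<open>finite S\<close> by (intro measure_finite_Union[symmetric]) (auto simp: less_top emeasure_lborel_ball_finite[unfolded infinity_ennreal_def])
  also have "\<dots> \<le> measure lebesgue (ball 0 (1 + \<epsilon> / 2) :: 'a set)"
    using sub \<open>finite S\<close> by (intro measure_mono_fmeasurable) auto
  also have "\<dots> = ?V * (1 + \<epsilon> / 2) ^ DIM('a)"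
    using \<open>\<epsilon> > 0\<close> by (simp add: content_ball)
  \<comment> \<open>Splitting off \<open>\<epsilon> / 2\<close> exposes the volume of one small ball
    on both sides, ready to be cancelled.\<close>
  also have "1 + \<epsilon> / 2 = (1 + 2 / \<epsilon>) * (\<epsilon> / 2)"
    using \<open>\<epsilon> > 0\<close> by (simp add: field_simps)
  finally have "real (card S) * (?V * (\<epsilon> / 2) ^ DIM('a))
      \<le> (1 + 2 / \<epsilon>) ^ DIM('a) * (?V * (\<epsilon> / 2) ^ DIM('a))"
    by (simp only: power_mult_distrib mult_ac)
  moreover have "?V * (\<epsilon> / 2) ^ DIM('a) > 0"
    using \<open>\<epsilon> > 0\<close> by simp
  ultimately show ?thesis
    by (rule mult_right_le_imp_le)
qed

text \<open>A separated subset of the sphere of largest cardinality is a net: a point at distance at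
  least \<open>\<epsilon>\<close> from all its members could be added to it. The packing bound
  controls its size and also guarantees that a largest one exists.\<close>

lemma ex_sphere_net:
  fixes \<epsilon> :: real
  assumes "\<epsilon> > 0"
  obtains N :: "'a::euclidean_space set"
  where "finite N" "N \<subseteq> sphere 0 1" "real (card N) \<le> (1 + 2 / \<epsilon>) ^ DIM('a)"
    and "\<And>v. v \<in> sphere 0 1 \<Longrightarrow> \<exists>u\<in>N. dist u v < \<epsilon>"
proof -
  define P where "P N \<longleftrightarrow> finite N \<and> N \<subseteq> sphere 0 1 \<and>
    (\<forall>x\<in>N. \<forall>y\<in>N. x \<noteq> y \<longrightarrow> dist x y \<ge> \<epsilon>)" for N :: "'a set"
  have card_le: "real (card N) \<le> (1 + 2 / \<epsilon>) ^ DIM('a)" if "P N" for N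
    using that assms unfolding P_def by (intro card_separated_le) auto
  have "P {}" by (simp add: P_def)
  moreover have "\<forall>N. P N \<longrightarrow> card N < Suc (nat \<lfloor>(1 + 2 / \<epsilon>) ^ DIM('a)\<rfloor>)"
    using card_le by (auto simp: less_Suc_eq_le le_nat_floor)
  ultimately obtain N where N: "P N" and maxi: "\<And>K. P K \<Longrightarrow> card K \<le> card N"
    using ex_has_greatest_nat[of P "{}" card] by blast
  show ?thesis
  proof
    fix v :: 'a assume v: "v \<in> sphere 0 1"
    show "\<exists>u\<in>N. dist u v < \<epsilon>"
    proof (rule ccontr)
      assume "\<not> ?thesis"
      then have far: "dist u v \<ge> \<epsilon>" if "u \<in> N" for u using that by force
      then have "P (insert v N)"
        using N v unfolding P_def by (auto simp: dist_commute)
      moreover have "v \<notin> N" using far[of v] assms by auto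
      ultimately show False using maxi[of "insert v N"] N by (simp add: P_def)
    qed
  qed (use N card_le in \<open>auto simp: P_def\<close>)
qed

text \<open>Strict separation gives a normal \<open>a\<close> with
  \<open>a \<bullet> x < a \<bullet> y\<close> on \<open>S\<close>; nonemptiness of \<open>S\<close>
  then forces \<open>a \<noteq> 0\<close>. The direction sought is \<open>- a\<close> normalised,
  and Cauchy-Schwarz replaces its inner product with \<open>x\<close> by the direction-free
  threshold \<open>norm x\<close>.\<close>

lemma not_in_hull_halfspace:
  fixes S :: "'a::euclidean_space set"
  assumes "finite S" "S \<noteq> {}" "x \<notin> convex hull S"
  obtains v where "norm v = 1" "\<And>y. y \<in> S \<Longrightarrow> v \<bullet> y < norm x"
proof -
  have "closed (convex hull S)"
    using assms by (simp add: compact_imp_closed finite_imp_compact_convex_hull)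
  then obtain a b where ab: "a \<bullet> x < b" "\<And>y. y \<in> convex hull S \<Longrightarrow> b < a \<bullet> y"
    using separating_hyperplane_closed_point[of "convex hull S" x] assms by auto
  have less: "a \<bullet> x < a \<bullet> y" if "y \<in> S" for y
    using ab that hull_inc[of y S convex] by force
  then have "a \<noteq> 0" using \<open>S \<noteq> {}\<close> by auto
  show ?thesis
  proof
    show "norm (- a /\<^sub>R norm a) = 1" using \<open>a \<noteq> 0\<close> by simp
    fix y assume "y \<in> S"
    have "- (a \<bullet> y) < - (a \<bullet> x)" using less[OF \<open>y \<in> S\<close>] by simp
    also have "\<dots> \<le> norm a * norm x"
      using Cauchy_Schwarz_ineq2[of a x] by simp
    finally show "(- a /\<^sub>R norm a) \<bullet> y < norm x"
      using \<open>a \<noteq> 0\<close> by (simp add: field_simps)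
  qed
qed

text \<open>Let \<open>b\<close> be the probability of \<open>u \<bullet> Y < - t\<close>. By
  symmetry \<open>u \<bullet> Y > t\<close> also has probability \<open>b\<close>, so the left side
  equals \<open>1 - b\<close>. It also equals \<open>b\<close> plus the probability of the slab;
  averaging the two expressions eliminates \<open>b\<close>.\<close>

lemma (in prob_space) symmetric_halfspace_prob:
  fixes Y :: "'a \<Rightarrow> 'b::euclidean_space"
  assumes [measurable]: "Y \<in> borel_measurable M"
    and sym: "distr M borel (\<lambda>\<omega>. - Y \<omega>) = distr M borel Y"
    and "t \<ge> 0"
  shows "prob {\<omega> \<in> space M. u \<bullet> Y \<omega> \<le> t}
    = 1 / 2 + prob {\<omega> \<in> space M. \<bar>u \<bullet> Y \<omega>\<bar> \<le> t} / 2"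
proof -
  let ?A = "{\<omega> \<in> space M. u \<bullet> Y \<omega> \<le> t}"
  let ?B = "{\<omega> \<in> space M. u \<bullet> Y \<omega> < - t}"
  let ?C = "{\<omega> \<in> space M. \<bar>u \<bullet> Y \<omega>\<bar> \<le> t}"
  have "prob ?B = measure (distr M borel Y) {y. u \<bullet> y < - t}"
    by (subst measure_distr) (auto intro!: arg_cong[where f=prob])
  also have "\<dots> = measure (distr M borel (\<lambda>\<omega>. - Y \<omega>)) {y. u \<bullet> y < - t}"
    by (simp only: sym)
  also have "\<dots> = prob (space M - ?A)"
    by (subst measure_distr) (auto intro!: arg_cong[where f=prob])
  also have "\<dots> = 1 - prob ?A"
    by (rule prob_compl) measurable
  finally have B: "prob ?B = 1 - prob ?A" .
  have "prob ?A = prob (?B \<union> ?C)"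
    using \<open>t \<ge> 0\<close> by (intro arg_cong[where f=prob]) auto
  also have "\<dots> = prob ?B + prob ?C"
    using \<open>t \<ge> 0\<close> by (intro finite_measure_Union) auto
  finally show ?thesis using B by simp
qed

lemma (in prob_space) prob_all_iid_in:
  assumes ind: "indep_vars (\<lambda>_. N) X I" and "finite I"
    and "\<And>i. i \<in> I \<Longrightarrow> distr M N (X i) = distr M N Y"
    and "Y \<in> measurable M N" and "A \<in> sets N"
  shows "prob {\<omega> \<in> space M. \<forall>i\<in>I. X i \<omega> \<in> A} = prob {\<omega> \<in> space M. Y \<omega> \<in> A} ^ card I"
\<comment> \<open>An intersection over the empty index set would be \<open>UNIV\<close> instead of
  \<open>space M\<close>, hence the case split.\<close>
proof (cases "I = {}")
  case True
  then show ?thesis by (simp add: prob_space)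
next
  case False
  have X: "X i \<in> measurable M N" if "i \<in> I" for i
    using ind that by (simp add: indep_vars_def)
  have "{\<omega> \<in> space M. \<forall>i\<in>I. X i \<omega> \<in> A} = (\<Inter>i\<in>I. X i -` A \<inter> space M)"
    using False by auto
  also have "prob \<dots> = (\<Prod>i\<in>I. prob (X i -` A \<inter> space M))"
    using assms False by (intro indep_varsD[OF ind]) auto
  also have "\<dots> = (\<Prod>i\<in>I. measure (distr M N (X i)) A)"
    using X \<open>A \<in> sets N\<close> by (simp add: measure_distr)
  also have "\<dots> = (\<Prod>i\<in>I. measure (distr M N Y) A)"
    using assms by (intro prod.cong) simp_all
  also have "\<dots> = prob (Y -` A \<inter> space M) ^ card I"
    using assms by (simp add: measure_distr)
  also have "Y -` A \<inter> space M = {\<omega> \<in> space M. Y \<omega> \<in> A}" by auto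
  finally show ?thesis .
qed

theorem theorem2p6:
  fixes M :: "'a measure"
    and Y :: "'a \<Rightarrow> real ^ 'p"
    and X :: "nat \<Rightarrow> 'a \<Rightarrow> real ^ 'p"
    and m :: nat
    and \<xi> \<Upsilon> \<rho> :: real
  assumes "prob_space M"
    and "Y \<in> borel_measurable M"
    and "prob_space.indep_vars M (\<lambda>_. borel) X {1..m}"
    and "\<And>i. i \<in> {1..m} \<Longrightarrow> distr M borel (X i) = distr M borel Y"
    and "distr M borel (\<lambda>\<omega>. - Y \<omega>) = distr M borel Y"
    and "\<xi> > 0" and "\<Upsilon> > 0"
    and "\<rho> = (SUP v \<in> sphere 0 1.
            measure M {\<omega> \<in> space M. \<bar>v \<bullet> Y \<omega>\<bar> \<le> 2 * \<xi>} / 2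
            + measure M {\<omega> \<in> space M. norm (Y \<omega>) \<ge> \<Upsilon>})"
    and "\<rho> < 1 / 2"
  shows "measure M {\<omega> \<in> space M.
            \<not> (\<lambda>x. \<xi> *\<^sub>R x) ` cball 0 1 \<subseteq> convex hull ((\<lambda>i. X i \<omega>) ` {1..m})}
         \<le> (1 + 2 * \<Upsilon> / \<xi>) ^ CARD('p) * (1 / 2 + \<rho>) ^ m"
\<comment> \<open>Without sample points the hull is empty and the separation lemma does not apply;
  the right side is then at least 1.\<close>
proof (cases "m = 0")
  case True
  interpret prob_space M by fact
  have "1 \<le> (1 + 2 * \<Upsilon> / \<xi>) ^ CARD('p)"
    using \<open>\<xi> > 0\<close> \<open>\<Upsilon> > 0\<close> by (intro one_le_power) simp
  with True show ?thesis
    by (auto intro: order_trans[OF prob_le_1])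
next
  case False
  interpret prob_space M by fact
  note [measurable] = \<open>Y \<in> borel_measurable M\<close>
  have X [measurable]: "X i \<in> borel_measurable M" if "i \<in> {1..m}" for i
    using assms(3) that by (simp add: indep_vars_def)
  \<comment> \<open>The threshold \<open>2 * \<xi>\<close> is \<open>\<xi>\<close> from the
    separation plus \<open>\<xi>\<close> for replacing the separating direction by a net
    point.\<close>
  define A where "A u = {x. norm x \<ge> \<Upsilon> \<or> u \<bullet> x \<le> 2 * \<xi>}" for u :: "real ^ 'p"
  have A [measurable]: "A u \<in> sets borel" for u
    unfolding A_def by measurable
  define E where "E u = {\<omega> \<in> space M. \<forall>i\<in>{1..m}. X i \<omega> \<in> A u}" for u
  have E [measurable]: "E u \<in> sets M" for u
    unfolding E_def by measurable
  have prob_A: "prob {\<omega> \<in> space M. Y \<omega> \<in> A u} \<le> 1 / 2 + \<rho>" if "u \<in> sphere 0 1" for u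
  proof -
    have "prob {\<omega> \<in> space M. Y \<omega> \<in> A u}
        = prob ({\<omega> \<in> space M. u \<bullet> Y \<omega> \<le> 2 * \<xi>} \<union> {\<omega> \<in> space M. norm (Y \<omega>) \<ge> \<Upsilon>})"
      by (auto simp: A_def intro!: arg_cong[where f=prob])
    also have "\<dots> \<le> prob {\<omega> \<in> space M. u \<bullet> Y \<omega> \<le> 2 * \<xi>} + prob {\<omega> \<in> space M. norm (Y \<omega>) \<ge> \<Upsilon>}"
      by (intro measure_Un_le) measurable
    also have "\<dots> = 1 / 2 + (prob {\<omega> \<in> space M. \<bar>u \<bullet> Y \<omega>\<bar> \<le> 2 * \<xi>} / 2
        + prob {\<omega> \<in> space M. norm (Y \<omega>) \<ge> \<Upsilon>})"
      using \<open>\<xi> > 0\<close> by (subst symmetric_halfspace_prob[OF assms(2,5)]) auto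
    also have "\<dots> \<le> 1 / 2 + \<rho>"
      \<comment> \<open>A real supremum dominates its terms only if they are bounded above;
        \<open>1 / 2 + 1\<close> serves, as both probabilities are at most 1.\<close>
      unfolding assms(8)
      by (intro add_left_mono cSUP_upper that bdd_aboveI2[where M = "1 / 2 + 1"] add_mono
          divide_right_mono prob_le_1) simp
    finally show ?thesis .
  qed
  have prob_E: "prob (E u) \<le> (1 / 2 + \<rho>) ^ m" if "u \<in> sphere 0 1" for u
  proof -
    have "prob (E u) = prob {\<omega> \<in> space M. Y \<omega> \<in> A u} ^ m"
      unfolding E_def using prob_all_iid_in[OF assms(3) _ assms(4,2) A] by simp
    then show ?thesis using prob_A[OF that] by (simp add: power_mono)
  qed
  \<comment> \<open>At mesh \<open>\<xi> / \<Upsilon>\<close>, moving the direction changes the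
    inner product with a vector shorter than \<open>\<Upsilon>\<close> by at most
    \<open>\<xi>\<close>.\<close>
  obtain N :: "(real ^ 'p) set" where N: "finite N" "N \<subseteq> sphere 0 1"
    "real (card N) \<le> (1 + 2 / (\<xi> / \<Upsilon>)) ^ DIM(real ^ 'p)"
    "\<And>v. v \<in> sphere 0 1 \<Longrightarrow> \<exists>u\<in>N. dist u v < \<xi> / \<Upsilon>"
    using ex_sphere_net[of "\<xi> / \<Upsilon>"] \<open>\<xi> > 0\<close> \<open>\<Upsilon> > 0\<close> by (metis divide_pos_pos)
  let ?F = "{\<omega> \<in> space M.
    \<not> (\<lambda>x. \<xi> *\<^sub>R x) ` cball 0 1 \<subseteq> convex hull ((\<lambda>i. X i \<omega>) ` {1..m})}"
  have sub: "?F \<subseteq> (\<Union>u\<in>N. E u)"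
  proof
    fix \<omega> assume "\<omega> \<in> ?F"
    then obtain x where \<omega>: "\<omega> \<in> space M" and x: "norm x \<le> 1"
      "\<xi> *\<^sub>R x \<notin> convex hull ((\<lambda>i. X i \<omega>) ` {1..m})"
      unfolding mem_Collect_eq image_subset_iff Ball_def mem_cball_0 by blast
    obtain v where v: "norm v = 1"
      "\<And>y. y \<in> (\<lambda>i. X i \<omega>) ` {1..m} \<Longrightarrow> v \<bullet> y < norm (\<xi> *\<^sub>R x)"
      using not_in_hull_halfspace[OF _ _ x(2)] False by auto
    obtain u where u: "u \<in> N" "dist u v < \<xi> / \<Upsilon>" using N(4)[of v] v by auto
    have "X i \<omega> \<in> A u" if i: "i \<in> {1..m}" for i
    proof (cases "norm (X i \<omega>) \<ge> \<Upsilon>")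
      case True
      then show ?thesis by (simp add: A_def)
    next
      case False
      have "u \<bullet> X i \<omega> = v \<bullet> X i \<omega> + (u - v) \<bullet> X i \<omega>"
        by (simp add: inner_diff_left)
      also have "(u - v) \<bullet> X i \<omega> \<le> norm (u - v) * norm (X i \<omega>)"
        by (rule norm_cauchy_schwarz)
      also have "\<dots> \<le> \<xi> / \<Upsilon> * \<Upsilon>"
        using u False \<open>\<xi> > 0\<close> \<open>\<Upsilon> > 0\<close> by (intro mult_mono) (auto simp: dist_norm)
      also have "\<dots> = \<xi>" using \<open>\<Upsilon> > 0\<close> by simp
      also have "v \<bullet> X i \<omega> \<le> norm (\<xi> *\<^sub>R x)" using v(2) i by (simp add: less_imp_le)
      also have "\<dots> \<le> \<xi>" using x(1) \<open>\<xi> > 0\<close> by simp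
      finally show ?thesis by (simp add: A_def)
    qed
    with \<omega> u(1) show "\<omega> \<in> (\<Union>u\<in>N. E u)"
      unfolding E_def by blast
  qed
  \<comment> \<open>Any unit vector will do: \<open>prob_A\<close> bounds a probability by this
    quantity. The sign is used when \<open>card N\<close> is replaced by its upper bound.\<close>
  have "0 \<le> 1 / 2 + \<rho>"
    using prob_A[of "axis undefined 1"] by (auto intro: order_trans[OF measure_nonneg])
  \<comment> \<open>Monotonicity asks for measurability of the larger set only, here a finite union
    of the measurable events \<open>E u\<close>.\<close>
  have "prob ?F \<le> prob (\<Union>u\<in>N. E u)"
    using sub \<open>finite N\<close> by (intro finite_measure_mono) auto
  also have "\<dots> \<le> (\<Sum>u\<in>N. prob (E u))"
    using \<open>finite N\<close> by (intro finite_measure_subadditive_finite) auto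
  also have "\<dots> \<le> (\<Sum>u\<in>N. (1 / 2 + \<rho>) ^ m)"
    using N(2) by (intro sum_mono prob_E) auto
  also have "\<dots> = real (card N) * (1 / 2 + \<rho>) ^ m" by simp
  also have "\<dots> \<le> (1 + 2 * \<Upsilon> / \<xi>) ^ CARD('p) * (1 / 2 + \<rho>) ^ m"
    using N(3) \<open>0 \<le> 1 / 2 + \<rho>\<close> by (intro mult_right_mono) auto
  finally show ?thesis .
qed

end
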